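(* Every extremal finite simple graph has induced matching number at most two. Moreover, if $G$ is an extremal finite simple graph and $S\subseteq V(G)$ is a set of four vertices such that $G[S]$ is isomorphic to $2K_2$, then $H=G-S$ is extremal and \[ \chi(H)=\chi(G)-2,\qquad \operatorname{lcc}(H)=\operatorname{lcc}(G)-2 . \]
   Context: A graph $G$ is called extremal if $\operatorname{lcc}(G)+\chi(G)=|V(G)|+1$. $\chi(G)$ is the chromatic number; $G[S]$ is the subgraph induced by $S$ and $G-S=G[V(G)\setminus S]$; $2K_2$ is the disjoint union of two edges. An induced matching is a set of pairwise disjoint edges whose endpoint set induces no further edges; the induced matching number is the maximum size of an induced matching. A clique is a set of pairwise adjacent vertices. An edge-clique cover of $G$ is a family of cliques of $G$ such that both ends of every edge of $G$ lie together in some member of the family. For such a cover $\mathcal C$, the valency of a vertex $v$ is $\operatorname{val}_{\mathcal C}(v)=|\{C\in\mathcal C: v\in C\}|$. The local clique cover number is $\operatorname{lcc}(G)=\min_{\mathcal C}\max_{v\in V(G)}\operatorname{val}_{\mathcal C}(v)$, the minimum taken over all edge-clique covers $\mathcal C$ of $G$. Conventions: $\operatorname{lcc}(G)=0$ for every edgeless graph, and the graph $\varnothing$ with no vertices has $\chi(\varnothing)=\operatorname{lcc}(\varnothing)=0$. *)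

theory Defs
  imports "Graph_Theory.Digraph_Isomorphism"
begin

text \<open>
  A finite simple graph is a digraph satisfying the locale predicate \<^const>\<open>graph\<close>: finite,
  loop-free, without parallel arcs, and symmetric. The null graph is allowed. An undirected edge
  is a pair of opposite arcs; where edges are counted they are represented by their
  two-element sets of ends.
\<close>

definition edge_ends :: "('a, 'b) pre_digraph \<Rightarrow> 'a set set" where
  "edge_ends G = {{u, v} | u v. u \<rightarrow>\<^bsub>G\<^esub> v}"

definition proper_colouring :: "('a, 'b) pre_digraph \<Rightarrow> nat \<Rightarrow> ('a \<Rightarrow> nat) \<Rightarrow> bool" where
  "proper_colouring G k c \<longleftrightarrow>
     (\<forall>v \<in> verts G. c v < k) \<and> (\<forall>u v. u \<rightarrow>\<^bsub>G\<^esub> v \<longrightarrow> c u \<noteq> c v)"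

definition chromatic_number :: "('a, 'b) pre_digraph \<Rightarrow> nat" where
  "chromatic_number G = (LEAST k. \<exists>c. proper_colouring G k c)"

definition clique :: "('a, 'b) pre_digraph \<Rightarrow> 'a set \<Rightarrow> bool" where
  "clique G C \<longleftrightarrow> C \<subseteq> verts G \<and> (\<forall>u \<in> C. \<forall>v \<in> C. u \<noteq> v \<longrightarrow> u \<rightarrow>\<^bsub>G\<^esub> v)"

definition edge_clique_cover :: "('a, 'b) pre_digraph \<Rightarrow> 'a set set \<Rightarrow> bool" where
  "edge_clique_cover G \<C> \<longleftrightarrow>
     (\<forall>C \<in> \<C>. clique G C) \<and> (\<forall>u v. u \<rightarrow>\<^bsub>G\<^esub> v \<longrightarrow> (\<exists>C \<in> \<C>. u \<in> C \<and> v \<in> C))"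

definition valency :: "'a set set \<Rightarrow> 'a \<Rightarrow> nat" where
  "valency \<C> v = card {C \<in> \<C>. v \<in> C}"

text \<open>
  Inserting \<open>0\<close> only matters for the null graph, where the maximum over the vertices would
  otherwise be taken over the empty set.
\<close>

definition max_valency :: "('a, 'b) pre_digraph \<Rightarrow> 'a set set \<Rightarrow> nat" where
  "max_valency G \<C> = Max (insert 0 (valency \<C> ` verts G))"

definition lcc :: "('a, 'b) pre_digraph \<Rightarrow> nat" where
  "lcc G = Min {max_valency G \<C> | \<C>. edge_clique_cover G \<C>}"

definition extremal :: "('a, 'b) pre_digraph \<Rightarrow> bool" where
  "extremal G \<longleftrightarrow> lcc G + chromatic_number G = card (verts G) + 1"

definition induced_matching :: "('a, 'b) pre_digraph \<Rightarrow> 'a set set \<Rightarrow> bool" where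
  "induced_matching G M \<longleftrightarrow>
     M \<subseteq> edge_ends G \<and> pairwise disjnt M \<and> edge_ends (G \<restriction> \<Union>M) = M"

definition induced_matching_number :: "('a, 'b) pre_digraph \<Rightarrow> nat" where
  "induced_matching_number G = Max {card M | M. induced_matching G M}"

definition two_K2 :: "nat pair_pre_digraph" where
  "two_K2 = \<lparr> pverts = {0, 1, 2, 3}, parcs = {(0, 1), (1, 0), (2, 3), (3, 2)} \<rparr>"


lemma graph_two_K2: "graph (with_proj two_K2)"
  by unfold_locales
    (auto simp: two_K2_def symmetric_def sym_def arc_to_ends_def)

lemma graph_induce_subgraph:
  assumes "graph G" "S \<subseteq> verts G"
  shows "graph (G \<restriction> S)"
proof -
  interpret graph G by fact
  have ind: "induced_subgraph (G \<restriction> S) G" using assms(2) by (rule induced_induce)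
  then interpret H: digraph "G \<restriction> S" by (rule digraphI_induced)
  interpret H: sym_digraph "G \<restriction> S" using ind by (rule induced_graph_imp_graph)
  show ?thesis by unfold_locales
qed

lemma edge_clique_cover_edge_ends:
  assumes "graph G"
  shows "edge_clique_cover G (edge_ends G)"
proof -
  interpret graph G by fact
  have sym: "v \<rightarrow>\<^bsub>G\<^esub> u" if "u \<rightarrow>\<^bsub>G\<^esub> v" for u v
    using that sym_arcs by (auto simp: symmetric_def sym_def)
  show ?thesis
    unfolding edge_clique_cover_def
  proof (intro conjI ballI allI impI)
    fix C assume "C \<in> edge_ends G"
    then obtain u v where "C = {u, v}" "u \<rightarrow>\<^bsub>G\<^esub> v" by (auto simp: edge_ends_def)
    then show "clique G C" using sym by (auto simp: clique_def)
  next
    fix u v assume "u \<rightarrow>\<^bsub>G\<^esub> v"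
    then show "\<exists>C \<in> edge_ends G. u \<in> C \<and> v \<in> C" by (auto simp: edge_ends_def)
  qed
qed

lemma finite_edge_clique_covers:
  assumes "finite (verts G)"
  shows "finite {\<C>. edge_clique_cover G \<C>}"
proof (rule finite_subset)
  show "{\<C>. edge_clique_cover G \<C>} \<subseteq> Pow (Pow (verts G))"
    by (auto simp: edge_clique_cover_def clique_def)
qed (use assms in simp)

lemma finite_induced_matchings:
  assumes "graph G"
  shows "finite {M. induced_matching G M}"
proof (rule finite_subset)
  interpret graph G by fact
  show "{M. induced_matching G M} \<subseteq> Pow (Pow (verts G))"
    by (auto simp: induced_matching_def edge_ends_def adj_in_verts dest!: subsetD)
  show "finite (Pow (Pow (verts G)))" by simp
qed

lemma induced_matching_empty: "induced_matching G {}"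
  by (auto simp: induced_matching_def edge_ends_def arcs_ends_conv)

lemma lcc_edgeless:
  assumes "graph G" "arcs G = {}"
  shows "lcc G = 0"
proof -
  interpret graph G by fact
  let ?A = "{max_valency G \<C> | \<C>. edge_clique_cover G \<C>}"
  have "edge_clique_cover G {}"
    using assms(2) by (auto simp: edge_clique_cover_def arcs_ends_def)
  moreover have "valency {} ` verts G \<subseteq> {0}" by (auto simp: valency_def)
  then have "insert 0 (valency {} ` verts G) = {0}" by auto
  then have "max_valency G {} = 0" unfolding max_valency_def by (simp only: Max_singleton)
  ultimately have "0 \<in> ?A" by force
  moreover have "finite ?A" using finite_edge_clique_covers[OF finite_verts] by simp
  ultimately have "Min ?A \<le> 0" by (intro Min_le)
  then show ?thesis by (simp add: lcc_def)
qed

lemma chromatic_number_null: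
  assumes "graph G" "verts G = {}"
  shows "chromatic_number G = 0"
proof -
  interpret graph G by fact
  have "proper_colouring G 0 c" for c
    using assms(2) adj_in_verts by (auto simp: proper_colouring_def)
  then show ?thesis unfolding chromatic_number_def by (intro Least_eq_0) blast
qed

end

theory Submission
  imports Defs
begin

text \<open>
  Everything rests on the inequality \<open>lcc G + chromatic_number G \<le> n + 1\<close> for a graph with \<open>n\<close>
  vertices (\<open>lcc_plus_chromatic_number_le\<close>). In an extremal graph, deleting the four vertices of
  an induced \<open>2K\<^sub>2\<close> lowers each parameter by at most two, and then equality must hold everywhere:
  the rest is extremal and each parameter drops by exactly two. Deleting an induced \<open>3K\<^sub>2\<close> lowers the
  chromatic number by at most two and \<open>lcc\<close> by at most three, while six vertices disappear, which
  contradicts extremality; so an induced matching has at most two edges.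

  For the chromatic number the claims are clear. For \<open>lcc\<close>, an edge \<open>ab\<close> is added to a
  clique cover of the rest as follows: split the remaining vertices by whether they see \<open>a\<close>, \<open>b\<close> or
  both, partition each part into cliques, and attach \<open>a\<close>, \<open>b\<close> or both to these cliques. Every old
  vertex gains valency at most one, so only the new valency of \<open>a\<close> and \<open>b\<close> can be large. It is the
  number of classes, which the inequality of Nordhaus and Gaddum turns into a bound on the number
  of colours: if many cliques are needed around \<open>a\<close>, then the whole graph has a colouring with few
  colours. As soon as \<open>a\<close> and \<open>b\<close> each have a non-neighbour, this gives valency at most \<open>n\<close> minus
  the chromatic number (\<open>edge_star_cover\<close>), and in an extremal graph that is less than \<open>lcc\<close>.

  The general inequality follows from the same construction. Call edges \<open>ab\<close> and \<open>cd\<close> with non-edges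
  \<open>ac\<close> and \<open>bd\<close> an alternating 4-cycle; its vertices span \<open>2K\<^sub>2\<close>, a path or a 4-cycle and
  can be coloured with two colours. Removing it gives an induction, where the possible edges \<open>ad\<close>
  and \<open>bc\<close> may cost their ends one more clique. Graphs without alternating 4-cycles are
  split graphs, for which a largest clique gives both a cover and a colouring.
\<close>

section \<open>Colourings, and the theorem of Nordhaus and Gaddum\<close>

definition colourable :: "('a \<Rightarrow> 'a \<Rightarrow> bool) \<Rightarrow> 'a set \<Rightarrow> nat \<Rightarrow> bool" where
  "colourable E X k \<longleftrightarrow>
     (\<exists>c. (\<forall>v\<in>X. c v < k) \<and> (\<forall>u\<in>X. \<forall>v\<in>X. E u v \<longrightarrow> c u \<noteq> c v))"

lemma colourable_Un:
  assumes "colourable E X k" "colourable E Y l"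
  shows "colourable E (X \<union> Y) (k + l)"
proof -
  obtain c where c: "\<forall>v\<in>X. c v < k" "\<forall>u\<in>X. \<forall>v\<in>X. E u v \<longrightarrow> c u \<noteq> c v"
    using assms(1) unfolding colourable_def by blast
  obtain d where d: "\<forall>v\<in>Y. d v < l" "\<forall>u\<in>Y. \<forall>v\<in>Y. E u v \<longrightarrow> d u \<noteq> d v"
    using assms(2) unfolding colourable_def by blast
  define e where "e v = (if v \<in> X then c v else k + d v)" for v
  have less: "e v < k \<longleftrightarrow> v \<in> X" if "v \<in> X \<union> Y" for v
    using c(1) that by (auto simp: e_def)
  have "e v < k + l" if "v \<in> X \<union> Y" for v
    using c(1) d(1) that by (auto simp: e_def trans_less_add1)
  moreover have "e u \<noteq> e v" if uv: "u \<in> X \<union> Y" "v \<in> X \<union> Y" "E u v" for u v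
  proof
    assume eq: "e u = e v"
    show False
    proof (cases "u \<in> X")
      case True
      then have "v \<in> X" using less[OF uv(1)] less[OF uv(2)] eq by simp
      then show False using True uv(3) c(2) eq by (auto simp: e_def)
    next
      case False
      then have "v \<notin> X" using less[OF uv(1)] less[OF uv(2)] eq by simp
      then show False using False uv d(2) eq by (auto simp: e_def)
    qed
  qed
  ultimately show ?thesis unfolding colourable_def by blast
qed

text \<open>
  If no colour class is free for \<open>v\<close>, then choosing a neighbour in every class gives \<open>k\<close> neighbours.
\<close>
lemma colourable_insert_or_degree:
  assumes "symp E" "irreflp E" "finite X" "v \<notin> X" "colourable E X k"
  shows "colourable E (insert v X) k \<or> k \<le> card {u \<in> X. E u v}"
proof -
  obtain c where c: "\<forall>u\<in>X. c u < k" "\<forall>u\<in>X. \<forall>w\<in>X. E u w \<longrightarrow> c u \<noteq> c w"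
    using assms(5) unfolding colourable_def by blast
  show ?thesis
  proof (cases "\<exists>i<k. \<forall>u\<in>X. E u v \<longrightarrow> c u \<noteq> i")
    case True
    then obtain i where i: "i < k" "\<forall>u\<in>X. E u v \<longrightarrow> c u \<noteq> i" by blast
    have "\<forall>u\<in>insert v X. (c(v := i)) u < k" using c(1) i(1) by auto
    moreover have "(c(v := i)) u \<noteq> (c(v := i)) w"
      if "u \<in> insert v X" "w \<in> insert v X" "E u w" for u w
      using that c(2) i(2) assms(4) sympD[OF assms(1)] irreflpD[OF assms(2)]
      by (auto simp: fun_upd_def)
    ultimately show ?thesis unfolding colourable_def by blast
  next
    case False
    then have "{..<k} \<subseteq> c ` {u \<in> X. E u v}" by fastforce
    then have "card {..<k} \<le> card {u \<in> X. E u v}"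
      by (rule surj_card_le[rotated]) (use assms(3) in simp)
    then show ?thesis by simp
  qed
qed

text \<open>
  Inequality of Nordhaus and Gaddum: a new vertex cannot have all \<open>k\<close> colour classes among its
  neighbours and all \<open>l\<close> classes of the complement among its non-neighbours unless \<open>k + l\<close> is at
  most the number of old vertices. Requiring one of the two numbers to be positive costs nothing,
  since the induction starts from the empty set, where \<open>k + l = 1\<close> is allowed.
\<close>
lemma nordhaus_gaddum:
  assumes E: "symp E" "irreflp E" and "finite X" and "k0 + l0 = 1"
  shows "\<exists>k l. k0 \<le> k \<and> l0 \<le> l \<and> k + l \<le> card X + 1 \<and>
    colourable E X k \<and> colourable (\<lambda>u v. u \<noteq> v \<and> \<not> E u v) X l"
  using \<open>finite X\<close>
proof induction
  case empty
  then show ?case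
    by (intro exI[of _ k0] exI[of _ l0]) (use assms(4) in \<open>simp add: colourable_def\<close>)
next
  case (insert v X)
  let ?N = "\<lambda>u v. u \<noteq> v \<and> \<not> E u v"
  have N: "symp ?N" "irreflp ?N"
    using E(1) by (auto simp: symp_def irreflp_def)
  obtain k l where kl: "k0 \<le> k" "l0 \<le> l" "k + l \<le> card X + 1" "colourable E X k"
    "colourable ?N X l" using insert.IH by blast
  have grow: "colourable R (insert v X) (j + 1)" if "colourable R X j" "irreflp R" for R j
  proof -
    have "colourable R {v} 1"
      using irreflpD[OF that(2)] by (auto simp: colourable_def)
    from colourable_Un[OF that(1) this] show ?thesis by simp
  qed
  have card: "card (insert v X) = card X + 1" using insert.hyps by simp
  consider "colourable E (insert v X) k" | "colourable ?N (insert v X) l"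
    | "k \<le> card {u \<in> X. E u v}" "l \<le> card {u \<in> X. ?N u v}"
    using colourable_insert_or_degree[OF E insert.hyps kl(4)]
      colourable_insert_or_degree[OF N insert.hyps kl(5)] by blast
  then show ?case
  proof cases
    case 1
    then show ?thesis
      by (intro exI[of _ k] exI[of _ "l + 1"]) (use kl grow[OF kl(5) N(2)] card in simp)
  next
    case 2
    then show ?thesis
      by (intro exI[of _ "k + 1"] exI[of _ l]) (use kl grow[OF kl(4) E(2)] card in simp)
  next
    case 3
    have "card {u \<in> X. E u v} + card {u \<in> X. ?N u v}
        = card ({u \<in> X. E u v} \<union> {u \<in> X. ?N u v})"
      using insert.hyps(1) by (subst card_Un_disjoint) auto
    also have "\<dots> \<le> card X" using insert.hyps(1) by (intro card_mono) auto
    finally have "k + l \<le> card X" using 3 by linarith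
    then show ?thesis
      by (intro exI[of _ "k + 1"] exI[of _ "l + 1"])
        (use kl grow[OF kl(5) N(2)] grow[OF kl(4) E(2)] card in simp)
  qed
qed


lemma card_eq_card_Diff_add:
  assumes "finite V" "S \<subseteq> V" shows "card V = card (V - S) + card S"
  using card_Diff_subset[OF finite_subset[OF assms(2,1)] assms(2)] card_mono[OF assms] by linarith


section \<open>Clique covers with bounded valency\<close>

lemma valency_Un_le: "valency (\<C> \<union> \<D>) v \<le> valency \<C> v + valency \<D> v"
proof -
  have "{C \<in> \<C> \<union> \<D>. v \<in> C} = {C \<in> \<C>. v \<in> C} \<union> {C \<in> \<D>. v \<in> C}" by blast
  then show ?thesis unfolding valency_def by (simp add: card_Un_le)
qed

lemma valency_eq_0: "(\<And>C. C \<in> \<C> \<Longrightarrow> v \<notin> C) \<Longrightarrow> valency \<C> v = 0"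
  unfolding valency_def by (metis (no_types, lifting) card.empty empty_Collect_eq)

lemma valency_le_1:
  assumes "\<And>C. C \<in> \<C> \<Longrightarrow> v \<in> C \<Longrightarrow> C = K"
  shows "valency \<C> v \<le> 1"
proof -
  have "{C \<in> \<C>. v \<in> C} \<subseteq> {K}" using assms by blast
  then have "card {C \<in> \<C>. v \<in> C} \<le> card {K}" by (intro card_mono) auto
  then show ?thesis by (simp add: valency_def)
qed

lemma valency_le_card: "finite \<C> \<Longrightarrow> valency \<C> v \<le> card \<C>"
  unfolding valency_def by (intro card_mono) auto

lemma of_bool_le_1: "of_bool P \<le> (1::nat)"
  by simp

definition is_clique :: "('a \<Rightarrow> 'a \<Rightarrow> bool) \<Rightarrow> 'a set \<Rightarrow> bool" where
  "is_clique E K \<longleftrightarrow> (\<forall>u\<in>K. \<forall>v\<in>K. u \<noteq> v \<longrightarrow> E u v)"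

text \<open>
  The valency is bounded by a function of the vertex, because the constructions below treat the
  ends of the edges that they add differently from the other vertices.
\<close>
definition coverable :: "('a \<Rightarrow> 'a \<Rightarrow> bool) \<Rightarrow> 'a set \<Rightarrow> ('a \<Rightarrow> nat) \<Rightarrow> bool" where
  "coverable E X f \<longleftrightarrow>
     (\<exists>\<C>. (\<forall>K\<in>\<C>. K \<subseteq> X \<and> is_clique E K) \<and>
          (\<forall>u\<in>X. \<forall>v\<in>X. E u v \<longrightarrow> (\<exists>K\<in>\<C>. u \<in> K \<and> v \<in> K)) \<and>
          (\<forall>v\<in>X. valency \<C> v \<le> f v))"

lemma coverable_mono:
  assumes "coverable E X f" "\<And>v. v \<in> X \<Longrightarrow> f v \<le> g v"
  shows "coverable E X g"
proof -
  obtain \<C> where C: "\<forall>K\<in>\<C>. K \<subseteq> X \<and> is_clique E K"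
    "\<forall>u\<in>X. \<forall>v\<in>X. E u v \<longrightarrow> (\<exists>K\<in>\<C>. u \<in> K \<and> v \<in> K)" "\<forall>v\<in>X. valency \<C> v \<le> f v"
    using assms(1) unfolding coverable_def by (elim exE conjE) (rule that)
  have "\<forall>v\<in>X. valency \<C> v \<le> g v" using C(3) assms(2) le_trans by blast
  with C(1,2) show ?thesis unfolding coverable_def by (intro exI[of _ \<C>] conjI)
qed

locale adjacency =
  fixes E :: "'a \<Rightarrow> 'a \<Rightarrow> bool"
  assumes sym: "E u v \<Longrightarrow> E v u" and irrefl: "\<not> E v v"
begin

lemma symp_E: "symp E" and irreflp_E: "irreflp E"
  using sym irrefl by (auto simp: symp_def irreflp_def)

lemma disjoint_if_nonadjacent:
  assumes "E a b" "E c d" "\<not> E a c" "\<not> E a d" "\<not> E b c" "\<not> E b d"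
  shows "a \<noteq> c \<and> a \<noteq> d \<and> b \<noteq> c \<and> b \<noteq> d"
  using assms sym[OF assms(2)] by auto

lemma colourable_card:
  assumes "finite X" shows "colourable E X (card X)"
proof -
  obtain c where "bij_betw c X {0..<card X}"
    using ex_bij_betw_finite_nat[OF assms] by blast
  then show ?thesis
    unfolding colourable_def bij_betw_def using irrefl
    by (intro exI[of _ c]) (auto dest: inj_onD)
qed

lemma colourable_nonadjacent_pair: "\<not> E a c \<Longrightarrow> colourable E {a, c} 1"
  unfolding colourable_def using sym irrefl by (intro exI[of _ "\<lambda>_. 0"]) auto

lemma colourable_insert_isolated:
  assumes "colourable E X k" "0 < k" "\<And>x. x \<in> X \<Longrightarrow> \<not> E b x"
  shows "colourable E (insert b X) k"
proof -
  obtain c where c: "\<forall>u\<in>X. c u < k" "\<forall>u\<in>X. \<forall>w\<in>X. E u w \<longrightarrow> c u \<noteq> c w"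
    using assms(1) unfolding colourable_def by blast
  have "E u w \<longrightarrow> u \<in> X \<and> w \<in> X" if "u \<in> insert b X" "w \<in> insert b X" for u w
    using that assms(3) sym irrefl by blast
  then show ?thesis unfolding colourable_def
    using c assms(2) by (intro exI[of _ "\<lambda>v. if v \<in> X then c v else 0"]) auto
qed

lemma is_clique_insert:
  "is_clique E K \<Longrightarrow> (\<And>v. v \<in> K \<Longrightarrow> E a v) \<Longrightarrow> is_clique E (insert a K)"
  unfolding is_clique_def using sym by blast

section \<open>Adding an edge to a cover\<close>

text \<open>
  Here \<open>X\<close> is a set of common neighbours of \<open>a\<close> and \<open>b\<close>, \<open>Y\<close> a set of vertices adjacent only to
  \<open>a\<close>, and \<open>lX\<close> and \<open>lY\<close> bound the numbers of cliques that partition them. Colouring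
  \<open>X\<close>, then \<open>Y\<close> with \<open>b\<close>, then \<open>a\<close> with its non-neighbour \<open>x\<close>, and every other vertex on its own,
  uses few colours when \<open>lX + lY\<close> is large. The colours of \<open>b\<close> and \<open>x\<close> are saved; \<open>kY\<close> must be
  positive because \<open>b\<close> needs a colour even if \<open>Y\<close> is empty.
\<close>
lemma colouring_around_edge:
  assumes V: "finite V" "a \<in> V" "b \<in> V" "x \<in> V" "X \<subseteq> V" "Y \<subseteq> V"
    and ab: "E a b" and ax: "\<not> E a x" "x \<noteq> a"
    and X: "\<And>v. v \<in> X \<Longrightarrow> E a v \<and> E b v" and Y: "\<And>v. v \<in> Y \<Longrightarrow> E a v \<and> \<not> E b v"
    and b: "b \<notin> Y"
    and kX: "colourable E X kX" "kX + lX \<le> card X + 1"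
    and kY: "colourable E Y kY" "kY + lY \<le> card Y + 1" "0 < kY"
  shows "\<exists>k. colourable E V k \<and> lX + lY + k \<le> card V"
proof -
  let ?U = "({a, x} \<union> insert b Y) \<union> X"
  define rest where "rest = V - ?U"
  have "a \<noteq> b" "b \<noteq> x" using ab ax irrefl by auto
  have "a \<notin> X" "a \<notin> Y" "x \<notin> X" "x \<notin> Y" "b \<notin> X" using X Y ax irrefl by blast+
  have fin: "finite X" "finite Y" "finite rest"
    using V finite_subset unfolding rest_def by auto
  have "X \<inter> Y = {}" using X Y by blast
  have U: "card ?U = card X + card Y + 3"
    using \<open>a \<notin> X\<close> \<open>a \<notin> Y\<close> \<open>x \<notin> X\<close> \<open>x \<notin> Y\<close> \<open>b \<notin> X\<close> \<open>X \<inter> Y = {}\<close> \<open>a \<noteq> b\<close> \<open>b \<noteq> x\<close> b ax fin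
    by (subst card_Un_disjoint) (auto simp: Int_commute)
  have "?U \<subseteq> V" using V(2-6) by blast
  then have rest: "card V = card ?U + card rest"
    unfolding rest_def using card_eq_card_Diff_add[OF V(1) \<open>?U \<subseteq> V\<close>] by linarith
  have V_eq: "?U \<union> rest = V" using \<open>?U \<subseteq> V\<close> unfolding rest_def by blast
  have "colourable E (insert b Y) kY"
    using colourable_insert_isolated[OF kY(1,3)] Y by blast
  then have "colourable E (?U \<union> rest) (1 + kY + kX + card rest)"
    by (intro colourable_Un colourable_nonadjacent_pair kX colourable_card fin ax)
  then show ?thesis unfolding V_eq
    by (intro exI[of _ "1 + kY + kX + card rest"]) (use rest U kX(2) kY(2) in simp)
qed

text \<open>
  Extend \<open>a\<close>, \<open>b\<close> or both by the classes of a partition into cliques of the vertices adjacent to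
  exactly \<open>a\<close>, exactly \<open>b\<close>, or both. A vertex of \<open>W\<close> lies in one class at most. At \<open>a\<close> the number
  of classes is controlled by Nordhaus and Gaddum, once for the common neighbours and once for
  those of \<open>a\<close> alone, and the matching colourings combine to one of all of \<open>V\<close>. The class
  of common neighbours is kept even if empty, for the sake of the edge from \<open>a\<close> to \<open>b\<close> itself.
\<close>
lemma edge_star_cover:
  assumes V: "finite V" "W \<subseteq> V" "a \<in> V - W" "b \<in> V - W" and ab: "E a b"
    and x: "x \<in> V" "x \<noteq> a" "\<not> E a x" and y: "y \<in> V" "y \<noteq> b" "\<not> E b y"
  obtains F where
    "\<And>K. K \<in> F \<Longrightarrow> K \<subseteq> W \<union> {a, b} \<and> is_clique E K"
    "\<And>u v. u \<in> {a, b} \<Longrightarrow> v \<in> W \<union> {a, b} \<Longrightarrow> E u v \<Longrightarrow> \<exists>K\<in>F. u \<in> K \<and> v \<in> K"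
    "\<And>v. v \<in> W \<Longrightarrow> valency F v \<le> of_bool (E v a \<or> E v b)"
    "\<exists>k. colourable E V k \<and> valency F a + k \<le> card V"
    "\<exists>k. colourable E V k \<and> valency F b + k \<le> card V"
proof -
  let ?N = "\<lambda>u v. u \<noteq> v \<and> \<not> E u v"
  define X where "X = {v \<in> W. E a v \<and> E b v}"
  define Y where "Y = {v \<in> W. E a v \<and> \<not> E b v}"
  define Z where "Z = {v \<in> W. \<not> E a v \<and> E b v}"
  have "finite W" using V(1,2) finite_subset by blast
  then have fin: "finite X" "finite Y" "finite Z" unfolding X_def Y_def Z_def by auto
  obtain kX lX where X: "1 \<le> lX" "kX + lX \<le> card X + 1" "colourable E X kX" "colourable ?N X lX"
    using nordhaus_gaddum[OF symp_E irreflp_E fin(1), of 0 1] by auto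
  obtain kY lY where Y: "1 \<le> kY" "kY + lY \<le> card Y + 1" "colourable E Y kY" "colourable ?N Y lY"
    using nordhaus_gaddum[OF symp_E irreflp_E fin(2), of 1 0] by auto
  obtain kZ lZ where Z: "1 \<le> kZ" "kZ + lZ \<le> card Z + 1" "colourable E Z kZ" "colourable ?N Z lZ"
    using nordhaus_gaddum[OF symp_E irreflp_E fin(3), of 1 0] by auto
  obtain dX where dX: "\<And>v. v \<in> X \<Longrightarrow> dX v < lX"
    "\<And>u v. u \<in> X \<Longrightarrow> v \<in> X \<Longrightarrow> dX u = dX v \<Longrightarrow> u \<noteq> v \<Longrightarrow> E u v"
    using X(4) unfolding colourable_def by blast
  obtain dY where dY: "\<And>v. v \<in> Y \<Longrightarrow> dY v < lY"
    "\<And>u v. u \<in> Y \<Longrightarrow> v \<in> Y \<Longrightarrow> dY u = dY v \<Longrightarrow> u \<noteq> v \<Longrightarrow> E u v"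
    using Y(4) unfolding colourable_def by blast
  obtain dZ where dZ: "\<And>v. v \<in> Z \<Longrightarrow> dZ v < lZ"
    "\<And>u v. u \<in> Z \<Longrightarrow> v \<in> Z \<Longrightarrow> dZ u = dZ v \<Longrightarrow> u \<noteq> v \<Longrightarrow> E u v"
    using Z(4) unfolding colourable_def by blast
  define PX where "PX i = insert a (insert b {v \<in> X. dX v = i})" for i
  define PY where "PY i = insert a {v \<in> Y. dY v = i}" for i
  define PZ where "PZ i = insert b {v \<in> Z. dZ v = i}" for i
  define F where "F = PX ` {..<lX} \<union> PY ` {..<lY} \<union> PZ ` {..<lZ}"
  have ne: "a \<noteq> b" "a \<notin> W" "b \<notin> W" using ab irrefl V by auto
  have notin: "a \<notin> X" "a \<notin> Y" "a \<notin> Z" "b \<notin> X" "b \<notin> Y" "b \<notin> Z"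
    using ne unfolding X_def Y_def Z_def by auto
  show thesis
  proof (rule that[of F])
    fix K assume "K \<in> F"
    then consider i where "K = PX i" | i where "K = PY i" | i where "K = PZ i"
      unfolding F_def by blast
    then show "K \<subseteq> W \<union> {a, b} \<and> is_clique E K"
    proof cases
      case 1
      have "is_clique E {v \<in> X. dX v = i}" using dX(2) unfolding is_clique_def by auto
      then have "is_clique E (PX i)" unfolding PX_def using ab
        by (intro is_clique_insert) (auto simp: X_def)
      then show ?thesis using 1 by (auto simp: PX_def X_def)
    next
      case 2
      have "is_clique E {v \<in> Y. dY v = i}" using dY(2) unfolding is_clique_def by auto
      then have "is_clique E (PY i)" unfolding PY_def
        by (intro is_clique_insert) (auto simp: Y_def)
      then show ?thesis using 2 by (auto simp: PY_def Y_def)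
    next
      case 3
      have "is_clique E {v \<in> Z. dZ v = i}" using dZ(2) unfolding is_clique_def by auto
      then have "is_clique E (PZ i)" unfolding PZ_def
        by (intro is_clique_insert) (auto simp: Z_def)
      then show ?thesis using 3 by (auto simp: PZ_def Z_def)
    qed
  next
    have X_in: "\<exists>K\<in>F. a \<in> K \<and> b \<in> K \<and> v \<in> K" if "v \<in> X" for v
      using dX(1)[OF that] that by (intro bexI[of _ "PX (dX v)"]) (auto simp: PX_def F_def)
    have Y_in: "\<exists>K\<in>F. a \<in> K \<and> v \<in> K" if "v \<in> Y" for v
      using dY(1)[OF that] that by (intro bexI[of _ "PY (dY v)"]) (auto simp: PY_def F_def)
    have Z_in: "\<exists>K\<in>F. b \<in> K \<and> v \<in> K" if "v \<in> Z" for v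
      using dZ(1)[OF that] that by (intro bexI[of _ "PZ (dZ v)"]) (auto simp: PZ_def F_def)
    have ab_in: "\<exists>K\<in>F. a \<in> K \<and> b \<in> K"
      using X(1) by (intro bexI[of _ "PX 0"]) (auto simp: PX_def F_def)
    fix u v assume uv: "u \<in> {a, b}" "v \<in> W \<union> {a, b}" "E u v"
    show "\<exists>K\<in>F. u \<in> K \<and> v \<in> K"
    proof (cases "v \<in> W")
      case False
      then show ?thesis using uv ab_in by auto
    next
      case True
      then consider "v \<in> X" | "v \<in> Y" "u = a" | "v \<in> Z" "u = b"
        using uv unfolding X_def Y_def Z_def by blast
      then show ?thesis using X_in Y_in Z_in uv(1) by cases blast+
    qed
  next
    fix v assume v: "v \<in> W"
    then have "v \<noteq> a" "v \<noteq> b" using ne by auto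
    show "valency F v \<le> of_bool (E v a \<or> E v b)"
    proof (cases "E v a \<or> E v b")
      case True
      have "valency F v \<le> 1"
        by (rule valency_le_1[of _ _ "if v \<in> X then PX (dX v) else if v \<in> Y then PY (dY v)
              else PZ (dZ v)"])
          (use \<open>v \<noteq> a\<close> \<open>v \<noteq> b\<close> in \<open>auto simp: F_def PX_def PY_def PZ_def X_def Y_def Z_def\<close>)
      then show ?thesis using True by simp
    next
      case False
      then have "v \<notin> X" "v \<notin> Y" "v \<notin> Z" using sym unfolding X_def Y_def Z_def by blast+
      then have "valency F v = 0"
        using \<open>v \<noteq> a\<close> \<open>v \<noteq> b\<close> by (intro valency_eq_0) (auto simp: F_def PX_def PY_def PZ_def)
      then show ?thesis by simp
    qed
  next
    have "{K \<in> F. a \<in> K} \<subseteq> PX ` {..<lX} \<union> PY ` {..<lY}"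
      using ne notin by (auto simp: F_def PZ_def)
    then have "valency F a \<le> card (PX ` {..<lX} \<union> PY ` {..<lY})"
      unfolding valency_def by (intro card_mono) auto
    also have "\<dots> \<le> card (PX ` {..<lX}) + card (PY ` {..<lY})" by (rule card_Un_le)
    also have "\<dots> \<le> lX + lY"
      using card_image_le[of "{..<lX}" PX] card_image_le[of "{..<lY}" PY] by simp
    finally have val: "valency F a \<le> lX + lY" .
    have "\<exists>k. colourable E V k \<and> lX + lY + k \<le> card V"
      by (rule colouring_around_edge[of V a b x X Y kX lX kY lY])
        (use V ab x X Y notin in \<open>auto simp: X_def Y_def\<close>)
    then show "\<exists>k. colourable E V k \<and> valency F a + k \<le> card V"
      using val by (meson add_le_mono1 order_trans)
  next
    have "{K \<in> F. b \<in> K} \<subseteq> PX ` {..<lX} \<union> PZ ` {..<lZ}"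
      using ne notin by (auto simp: F_def PY_def)
    then have "valency F b \<le> card (PX ` {..<lX} \<union> PZ ` {..<lZ})"
      unfolding valency_def by (intro card_mono) auto
    also have "\<dots> \<le> card (PX ` {..<lX}) + card (PZ ` {..<lZ})" by (rule card_Un_le)
    also have "\<dots> \<le> lX + lZ"
      using card_image_le[of "{..<lX}" PX] card_image_le[of "{..<lZ}" PZ] by simp
    finally have val: "valency F b \<le> lX + lZ" .
    have "\<exists>k. colourable E V k \<and> lX + lZ + k \<le> card V"
      by (rule colouring_around_edge[of V b a y X Z kX lX kZ lZ])
        (use V sym[OF ab] y X Z notin in \<open>auto simp: X_def Z_def\<close>)
    then show "\<exists>k. colourable E V k \<and> valency F b + k \<le> card V"
      using val by (meson add_le_mono1 order_trans)
  qed
qed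

text \<open>
  Think of \<open>s\<close> as \<open>card V\<close> minus the chromatic number of \<open>V\<close>, and of \<open>x\<close> and \<open>y\<close> as belonging to
  another edge that is added as well.
\<close>
lemma coverable_add_edge:
  assumes V: "finite V" "W \<subseteq> V" "a \<in> V - W" "b \<in> V - W" and ab: "E a b"
    and x: "x \<in> V" "x \<noteq> a" "\<not> E a x" and y: "y \<in> V" "y \<noteq> b" "\<not> E b y"
    and s: "\<forall>k. colourable E V k \<longrightarrow> card V \<le> s + k"
    and cov: "coverable E W f"
  shows "coverable E (W \<union> {a, b}) (\<lambda>v. if v \<in> {a, b} then s else f v + of_bool (E v a \<or> E v b))"
proof -
  obtain \<C> where C: "\<forall>K\<in>\<C>. K \<subseteq> W \<and> is_clique E K"
    "\<forall>u\<in>W. \<forall>v\<in>W. E u v \<longrightarrow> (\<exists>K\<in>\<C>. u \<in> K \<and> v \<in> K)" "\<forall>v\<in>W. valency \<C> v \<le> f v"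
    using cov unfolding coverable_def by blast
  obtain F where F: "\<And>K. K \<in> F \<Longrightarrow> K \<subseteq> W \<union> {a, b} \<and> is_clique E K"
    "\<And>u v. u \<in> {a, b} \<Longrightarrow> v \<in> W \<union> {a, b} \<Longrightarrow> E u v \<Longrightarrow> \<exists>K\<in>F. u \<in> K \<and> v \<in> K"
    "\<And>v. v \<in> W \<Longrightarrow> valency F v \<le> of_bool (E v a \<or> E v b)"
    "\<exists>k. colourable E V k \<and> valency F a + k \<le> card V"
    "\<exists>k. colourable E V k \<and> valency F b + k \<le> card V"
    using edge_star_cover[OF V ab x y] by blast
  have F_ends: "valency F v \<le> s" if "v \<in> {a, b}" for v
  proof -
    have "\<exists>k. colourable E V k \<and> valency F v + k \<le> card V" using F(4,5) that by fastforce
    then obtain k where "colourable E V k" "valency F v + k \<le> card V" by blast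
    with s show ?thesis by fastforce
  qed
  have C_ends: "valency \<C> v = 0" if "v \<in> {a, b}" for v
  proof (rule valency_eq_0)
    fix K assume "K \<in> \<C>"
    then show "v \<notin> K" using C(1) that V(3,4) by blast
  qed
  have ends: "valency (\<C> \<union> F) v \<le> s" if "v \<in> {a, b}" for v
    using valency_Un_le[of \<C> F v] F_ends[OF that] C_ends[OF that] by linarith
  have others: "valency (\<C> \<union> F) v \<le> f v + of_bool (E v a \<or> E v b)" if "v \<in> W" for v
    using valency_Un_le[of \<C> F v] F(3)[OF that] C(3)[rule_format, OF that] by linarith
  show ?thesis
    unfolding coverable_def
  proof (intro exI[of _ "\<C> \<union> F"] conjI ballI impI)
    fix K assume "K \<in> \<C> \<union> F"
    then show "K \<subseteq> W \<union> {a, b}" "is_clique E K" using C(1) F(1) by auto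
  next
    fix u v assume uv: "u \<in> W \<union> {a, b}" "v \<in> W \<union> {a, b}" "E u v"
    then consider "u \<in> W" "v \<in> W" | "u \<in> {a, b}" | "v \<in> {a, b}" by blast
    then show "\<exists>K\<in>\<C> \<union> F. u \<in> K \<and> v \<in> K"
    proof cases
      case 1
      then show ?thesis using C(2) uv(3) by blast
    next
      case 2
      from F(2)[OF 2 uv(2,3)] show ?thesis by blast
    next
      case 3
      from F(2)[OF 3 uv(1) sym[OF uv(3)]] show ?thesis by blast
    qed
  next
    fix v assume v: "v \<in> W \<union> {a, b}"
    show "valency (\<C> \<union> F) v \<le> (if v \<in> {a, b} then s else f v + of_bool (E v a \<or> E v b))"
    proof (cases "v \<in> {a, b}")
      case True
      then show ?thesis using ends[OF True] by (simp only: if_True)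
    next
      case False
      then have "v \<in> W" using v by blast
      from others[OF this] False show ?thesis by (simp only: if_False)
    qed
  qed
qed


section \<open>The upper bound\<close>

lemma colourable_alternating_cycle:
  assumes "\<not> E a c" "\<not> E b d" shows "colourable E {a, b, c, d} 2"
proof -
  have "colourable E ({a, c} \<union> {b, d}) (1 + 1)"
    using assms by (intro colourable_Un colourable_nonadjacent_pair)
  moreover have "{a, c} \<union> {b, d} = {a, b, c, d}" by auto
  ultimately show ?thesis by (simp add: numeral_2_eq_2)
qed

text \<open>
  The edges \<open>ab\<close> and \<open>cd\<close> are added one after the other; each provides the non-neighbours that the
  other one needs. A possible edge \<open>ad\<close> or \<open>bc\<close> is covered when \<open>cd\<close> is added, which is why the
  valency of \<open>a\<close> and \<open>b\<close> can exceed \<open>s\<close> by one.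
\<close>
lemma coverable_alternating_cycle:
  assumes V: "finite V" "{a, b, c, d} \<subseteq> V" and edges: "E a b" "E c d"
    and nonedges: "\<not> E a c" "\<not> E b d" "a \<noteq> c" "b \<noteq> d"
    and s: "\<forall>k. colourable E V k \<longrightarrow> card V \<le> s + k"
    and cov: "coverable E (V - {a, b, c, d}) (\<lambda>_. m)"
  shows "coverable E V (\<lambda>v. if v \<in> {c, d} then s
      else if v \<in> {a, b} then s + of_bool (E v c \<or> E v d) else m + 2)"
proof -
  have ne: "a \<noteq> d" "b \<noteq> c" using edges nonedges sym by blast+
  have nonedges': "\<not> E c a" "\<not> E d b" using nonedges sym by blast+
  let ?W = "V - {a, b, c, d}"
  have 1: "coverable E (?W \<union> {a, b})
      (\<lambda>v. if v \<in> {a, b} then s else m + of_bool (E v a \<or> E v b))"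
    by (rule coverable_add_edge[OF V(1) _ _ _ edges(1) _ _ nonedges(1) _ _ nonedges(2) s cov])
      (use V nonedges(3,4) in auto)
  have 2: "coverable E (?W \<union> {a, b} \<union> {c, d}) (\<lambda>v. if v \<in> {c, d} then s else
      (if v \<in> {a, b} then s else m + of_bool (E v a \<or> E v b)) + of_bool (E v c \<or> E v d))"
    by (rule coverable_add_edge[OF V(1) _ _ _ edges(2) _ _ nonedges'(1) _ _ nonedges'(2) s 1])
      (use V nonedges(3,4) ne in auto)
  have W_eq: "?W \<union> {a, b} \<union> {c, d} = V" using V by auto
  show ?thesis
  proof (rule coverable_mono[OF 2[unfolded W_eq]])
    fix v
    show "(if v \<in> {c, d} then s
        else (if v \<in> {a, b} then s else m + of_bool (E v a \<or> E v b)) + of_bool (E v c \<or> E v d))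
      \<le> (if v \<in> {c, d} then s
        else if v \<in> {a, b} then s + of_bool (E v c \<or> E v d) else m + 2)"
      using of_bool_le_1[of "E v a \<or> E v b"] of_bool_le_1[of "E v c \<or> E v d"]
      by (cases "v \<in> {c, d}"; cases "v \<in> {a, b}"; simp only: if_True if_False; linarith)
  qed
qed

text \<open>
  A graph without alternating 4-cycle is a threshold graph, hence split. For a largest clique \<open>K\<close>:
  an edge outside \<open>K\<close> would form an alternating cycle with two vertices of \<open>K\<close>, or else both its
  ends would miss the same single vertex of \<open>K\<close> and could replace it. So the rest is
  independent, and each vertex of it can take the colour of a vertex of \<open>K\<close> that it misses. Covering
  by \<open>K\<close> and by the closed neighbourhoods of the other vertices gives the valency.
\<close>
lemma bound_if_no_alternating_cycle:
  assumes V: "finite V"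
    and no: "\<And>a b c d. {a, b, c, d} \<subseteq> V \<Longrightarrow> E a b \<Longrightarrow> E c d \<Longrightarrow> \<not> E a c \<Longrightarrow> \<not> E b d \<Longrightarrow>
       a = c \<or> b = d"
  shows "\<exists>m k. colourable E V k \<and> coverable E V (\<lambda>_. m) \<and> m + k \<le> card V + 1"
proof -
  let ?S = "{K. K \<subseteq> V \<and> is_clique E K}"
  have fin: "finite ?S" by (rule finite_subset[of _ "Pow V"]) (use V in auto)
  have "{} \<in> ?S" by (simp add: is_clique_def)
  then have "Max (card ` ?S) \<in> card ` ?S" using fin by (intro Max_in) auto
  then obtain K where K: "K \<subseteq> V" "is_clique E K" and K_card: "card K = Max (card ` ?S)" by auto
  have max: "card L \<le> card K" if "L \<subseteq> V" "is_clique E L" for L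
    unfolding K_card by (rule Max_ge) (use that fin in auto)
  have fK: "finite K" using K(1) V finite_subset by blast
  have missed: "\<exists>p\<in>K. \<not> E x p" if x: "x \<in> V - K" for x
  proof (rule ccontr)
    assume "\<not> (\<exists>p\<in>K. \<not> E x p)"
    then have "is_clique E (insert x K)" using K(2) is_clique_insert by blast
    from max[OF _ this] show False using x K(1) fK by simp
  qed
  have indep: "\<not> E x y" if x: "x \<in> V - K" and y: "y \<in> V - K" for x y
  proof
    assume xy: "E x y"
    then have "x \<noteq> y" using irrefl by auto
    obtain p where p: "p \<in> K" "\<not> E x p" using missed[OF x] by blast
    (* the only use of the absence of alternating cycles: here with edges xy and qr *)
    have same: "q = r" if "q \<in> K" "\<not> E x q" "r \<in> K" "\<not> E y r" for q r
    proof (rule ccontr)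
      assume "q \<noteq> r"
      then have "E q r" using K(2) that unfolding is_clique_def by blast
      then have "x = q \<or> y = r" using no[of x y q r] that xy x y K(1) by blast
      then show False using that x y by blast
    qed
    obtain r where r: "r \<in> K" "\<not> E y r" using missed[OF y] by blast
    then have "r = p" using same[OF p r] by simp
    then have "E x q" "E y q" if "q \<in> K - {p}" for q
      using that same[of q p] same[of p q] p r by auto
    moreover have "is_clique E (K - {p})" using K(2) unfolding is_clique_def by blast
    ultimately have "is_clique E (insert x (insert y (K - {p})))"
      using xy by (intro is_clique_insert) auto
    moreover have "insert x (insert y (K - {p})) \<subseteq> V" using K(1) x y by blast
    ultimately have "card (insert x (insert y (K - {p}))) \<le> card K" using max by blast
    moreover have "card (insert x (insert y (K - {p}))) = Suc (Suc (card (K - {p})))"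
      using \<open>x \<noteq> y\<close> x y fK by (subst card_insert_disjoint; auto)+
    ultimately show False using card_Suc_Diff1[OF fK p(1)] by linarith
  qed
  obtain m where m: "\<And>x. x \<in> V - K \<Longrightarrow> m x \<in> K \<and> \<not> E x (m x)"
    using missed by metis
  obtain c where "bij_betw c K {0..<card K}" using ex_bij_betw_finite_nat[OF fK] by blast
  then have c: "c v < card K" if "v \<in> K" for v
    using that unfolding bij_betw_def by auto
  have c_inj: "inj_on c K" using \<open>bij_betw c K {0..<card K}\<close> by (rule bij_betw_imp_inj_on)
  have "colourable E V (card K)"
    unfolding colourable_def
  proof (intro exI[of _ "\<lambda>v. if v \<in> K then c v else c (m v)"] conjI ballI impI)
    fix v assume "v \<in> V"
    then show "(if v \<in> K then c v else c (m v)) < card K" using c m by auto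
  next
    fix u v assume uv: "u \<in> V" "v \<in> V" "E u v"
    have ne: "c p \<noteq> c q" if "p \<in> K" "q \<in> K" "p \<noteq> q" for p q
      using c_inj that by (auto dest: inj_onD)
    consider "u \<in> K" "v \<in> K" | "u \<in> V - K" "v \<in> K" | "v \<in> V - K" "u \<in> K"
      using uv indep by blast
    then show "(if u \<in> K then c u else c (m u)) \<noteq> (if v \<in> K then c v else c (m v))"
    proof cases
      case 1
      have "u \<noteq> v" using uv(3) irrefl by blast
      then show ?thesis using 1 ne[of u v] by simp
    next
      case 2
      have "m u \<noteq> v" using m[OF 2(1)] uv(3) by blast
      then show ?thesis using 2 m[OF 2(1)] ne[of "m u" v] by simp
    next
      case 3
      have "u \<noteq> m v" using m[OF 3(1)] sym[OF uv(3)] by blast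
      then show ?thesis using 3 m[OF 3(1)] ne[of u "m v"] by simp
    qed
  qed
  moreover have "coverable E V (\<lambda>_. card (V - K) + 1)"
  proof -
    define P where "P x = insert x {v \<in> K. E x v}" for x
    define \<C> where "\<C> = insert K (P ` (V - K))"
    have fin_C: "finite \<C>" using V unfolding \<C>_def by simp
    have "card \<C> \<le> Suc (card (P ` (V - K)))"
      unfolding \<C>_def by (rule card_insert_le_m1) simp_all
    moreover have "card (P ` (V - K)) \<le> card (V - K)" using V by (intro card_image_le) auto
    ultimately have card_C: "card \<C> \<le> card (V - K) + 1" by linarith
    have val: "valency \<C> v \<le> card (V - K) + 1" for v
      using valency_le_card[OF fin_C] card_C by (rule le_trans)
    have cliques: "L \<subseteq> V \<and> is_clique E L" if "L \<in> \<C>" for L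
    proof -
      have "is_clique E (P x)" for x
        unfolding P_def by (rule is_clique_insert) (use K(2) in \<open>auto simp: is_clique_def\<close>)
      then show ?thesis using that K by (auto simp: \<C>_def P_def)
    qed
    have edges: "\<exists>L\<in>\<C>. u \<in> L \<and> v \<in> L" if uv: "u \<in> V" "v \<in> V" "E u v" for u v
    proof -
      consider "u \<in> K" "v \<in> K" | "u \<in> V - K" "v \<in> K" | "v \<in> V - K" "u \<in> K"
        using uv indep by blast
      then show ?thesis
        by cases (use uv sym[OF uv(3)] in \<open>auto simp: \<C>_def P_def\<close>)
    qed
    show ?thesis
      unfolding coverable_def
    proof (intro exI[of _ \<C>] conjI ballI impI)
      show "L \<subseteq> V" "is_clique E L" if "L \<in> \<C>" for L using cliques[OF that] by auto
    qed (rule val edges; assumption)+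
  qed
  moreover have "card (V - K) + card K = card V" using card_eq_card_Diff_add[OF V K(1)] by simp
  ultimately show ?thesis
    by (intro exI[of _ "card (V - K) + 1"] exI[of _ "card K"]) simp
qed

text \<open>
  The general bound, by removing alternating 4-cycles. If the new valency is attained on the cycle,
  then it is at most one more than \<open>s\<close>, which is small for an optimal colouring.
\<close>
theorem ex_cover_and_colouring:
  assumes "finite V"
  shows "\<exists>m k. colourable E V k \<and> coverable E V (\<lambda>_. m) \<and> m + k \<le> card V + 1"
  using assms
proof (induction "card V" arbitrary: V rule: less_induct)
  case less
  show ?case
  proof (cases "\<exists>a b c d. {a, b, c, d} \<subseteq> V \<and> E a b \<and> E c d \<and> \<not> E a c \<and> \<not> E b d \<and> a \<noteq> c \<and> b \<noteq> d")
    case False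
    show ?thesis
    proof (rule bound_if_no_alternating_cycle[OF less.prems])
      fix a b c d
      assume "{a, b, c, d} \<subseteq> V" "E a b" "E c d" "\<not> E a c" "\<not> E b d"
      with False show "a = c \<or> b = d" by meson
    qed
  next
    case True
    then obtain a b c d where S: "{a, b, c, d} \<subseteq> V" and edges: "E a b" "E c d"
      and non: "\<not> E a c" "\<not> E b d" "a \<noteq> c" "b \<noteq> d" by (elim exE conjE) (rule that)
    let ?W = "V - {a, b, c, d}"
    have "a \<noteq> b" "c \<noteq> d" "a \<noteq> d" "b \<noteq> c" using edges non sym irrefl by blast+
    then have "card {a, b, c, d} = 4" using non by simp
    then have card: "card V = card ?W + 4" using card_eq_card_Diff_add[OF less.prems S] by simp
    then have "card ?W < card V" by linarith
    from less.hyps[OF this finite_Diff[OF less.prems]]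
    obtain m k where mk: "colourable E ?W k" "coverable E ?W (\<lambda>_. m)" "m + k \<le> card ?W + 1"
      by (elim exE conjE) (rule that)
    define q where "q = (LEAST k. colourable E V k)"
    have q: "colourable E V q"
      unfolding q_def using colourable_card[OF less.prems] by (rule LeastI)
    have q_le: "q \<le> j" if "colourable E V j" for j
      unfolding q_def using that by (rule Least_le)
    have "q \<le> card V" using q_le colourable_card[OF less.prems] by blast
    have "?W \<union> {a, b, c, d} = V" using S by auto
    then have "colourable E V (k + 2)"
      using colourable_Un[OF mk(1) colourable_alternating_cycle[OF non(1,2)]] by simp
    then have "q \<le> k + 2" by (rule q_le)
    have "card V \<le> card V - q + j" if "colourable E V j" for j
      using q_le[OF that] by linarith
    then have "\<forall>j. colourable E V j \<longrightarrow> card V \<le> card V - q + j" by blast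
    from coverable_alternating_cycle[OF less.prems S edges non this mk(2)]
    have cov: "coverable E V (\<lambda>_. max (m + 2) (card V - q + 1))"
    proof (rule coverable_mono)
      fix v
      show "(if v \<in> {c, d} then card V - q else if v \<in> {a, b}
          then card V - q + of_bool (E v c \<or> E v d) else m + 2) \<le> max (m + 2) (card V - q + 1)"
        using of_bool_le_1[of "E v c \<or> E v d"]
        by (cases "v \<in> {c, d}"; cases "v \<in> {a, b}"; simp only: if_True if_False; linarith)
    qed
    have "max (m + 2) (card V - q + 1) + q \<le> card V + 1"
      using \<open>q \<le> k + 2\<close> \<open>q \<le> card V\<close> card mk(3) by linarith
    with q cov show ?thesis by (intro exI conjI)
  qed
qed

text \<open>
  If no edge joins the two edges, then their ends gain nothing from each other, and the bound for
  their valency improves by one. This is what makes extremality pass to the rest.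
\<close>
lemma coverable_add_2K2:
  assumes V: "finite V" "{a, b, c, d} \<subseteq> V" and edges: "E a b" "E c d"
    and nonedges: "\<not> E a c" "\<not> E a d" "\<not> E b c" "\<not> E b d"
    and s: "\<forall>k. colourable E V k \<longrightarrow> card V \<le> s + k"
    and cov: "coverable E (V - {a, b, c, d}) (\<lambda>_. m)"
  shows "coverable E V (\<lambda>_. max s (m + 2))"
proof -
  have "a \<noteq> c" "b \<noteq> d" using disjoint_if_nonadjacent[OF edges nonedges] by blast+
  from coverable_alternating_cycle[OF V edges nonedges(1,4) this s cov]
  show ?thesis
  proof (rule coverable_mono)
    fix v
    show "(if v \<in> {c, d} then s else if v \<in> {a, b} then s + of_bool (E v c \<or> E v d) else m + 2)
        \<le> max s (m + 2)"
      using nonedges by auto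
  qed
qed

text \<open>
  Each edge finds the non-neighbours of its ends in another edge, and adding it costs the ends of
  the other edges nothing.
\<close>
lemma coverable_add_3K2:
  assumes V: "finite V" "{a, b, c, d, e, f} \<subseteq> V" and edges: "E a b" "E c d" "E e f"
    and nonedges: "\<not> E a c" "\<not> E a d" "\<not> E b c" "\<not> E b d"
      "\<not> E a e" "\<not> E a f" "\<not> E b e" "\<not> E b f" "\<not> E c e" "\<not> E c f" "\<not> E d e" "\<not> E d f"
    and s: "\<forall>k. colourable E V k \<longrightarrow> card V \<le> s + k"
    and cov: "coverable E (V - {a, b, c, d, e, f}) (\<lambda>_. m)"
  shows "coverable E V (\<lambda>_. max s (m + 3))"
proof -
  have ne: "a \<noteq> c" "a \<noteq> d" "b \<noteq> c" "b \<noteq> d" "a \<noteq> e" "a \<noteq> f" "b \<noteq> e" "b \<noteq> f"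
    "c \<noteq> e" "c \<noteq> f" "d \<noteq> e" "d \<noteq> f"
    using disjoint_if_nonadjacent[OF edges(1,2) nonedges(1-4)]
      disjoint_if_nonadjacent[OF edges(1,3) nonedges(5-8)]
      disjoint_if_nonadjacent[OF edges(2,3) nonedges(9-12)] by blast+
  have nonedges': "\<not> E c a" "\<not> E d b" "\<not> E e a" "\<not> E f b"
    using nonedges sym by blast+
  let ?W = "V - {a, b, c, d, e, f}"
  have 1: "coverable E (?W \<union> {a, b})
      (\<lambda>v. if v \<in> {a, b} then s else m + of_bool (E v a \<or> E v b))"
    by (rule coverable_add_edge[OF V(1) _ _ _ edges(1) _ _ nonedges(1) _ _ nonedges(4) s cov])
      (use V ne in auto)
  have 2: "coverable E (?W \<union> {a, b} \<union> {c, d}) (\<lambda>v. if v \<in> {c, d} then s else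
      (if v \<in> {a, b} then s else m + of_bool (E v a \<or> E v b)) + of_bool (E v c \<or> E v d))"
    by (rule coverable_add_edge[OF V(1) _ _ _ edges(2) _ _ nonedges'(1) _ _ nonedges'(2) s 1])
      (use V ne in auto)
  have 3: "coverable E (?W \<union> {a, b} \<union> {c, d} \<union> {e, f}) (\<lambda>v. if v \<in> {e, f} then s else
      (if v \<in> {c, d} then s else
      (if v \<in> {a, b} then s else m + of_bool (E v a \<or> E v b)) + of_bool (E v c \<or> E v d)) +
      of_bool (E v e \<or> E v f))"
    by (rule coverable_add_edge[OF V(1) _ _ _ edges(3) _ _ nonedges'(3) _ _ nonedges'(4) s 2])
      (use V ne in auto)
  have W_eq: "?W \<union> {a, b} \<union> {c, d} \<union> {e, f} = V" using V by auto
  show ?thesis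
  proof (rule coverable_mono[OF 3[unfolded W_eq]])
    fix v
    consider "v \<in> {a, b, c, d, e, f}" | "v \<notin> {a, b}" "v \<notin> {c, d}" "v \<notin> {e, f}" by blast
    then show "(if v \<in> {e, f} then s else
      (if v \<in> {c, d} then s else
      (if v \<in> {a, b} then s else m + of_bool (E v a \<or> E v b)) + of_bool (E v c \<or> E v d)) +
      of_bool (E v e \<or> E v f)) \<le> max s (m + 3)"
    proof cases
      case 1
      then show ?thesis using nonedges by (elim insertE) simp_all
    next
      case 2
      then show ?thesis
        using of_bool_le_1[of "E v a \<or> E v b"] of_bool_le_1[of "E v c \<or> E v d"]
          of_bool_le_1[of "E v e \<or> E v f"]
        by (simp only: if_False)
    qed
  qed
qed

end


section \<open>The parameters of a graph\<close>

abbreviation adj :: "('a, 'b) pre_digraph \<Rightarrow> 'a \<Rightarrow> 'a \<Rightarrow> bool" where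
  "adj G \<equiv> \<lambda>u v. u \<rightarrow>\<^bsub>G\<^esub> v"

lemma adjacency_adj:
  assumes "graph G" shows "adjacency (adj G)"
proof -
  interpret graph G by fact
  show ?thesis
  proof
    show "v \<rightarrow>\<^bsub>G\<^esub> u" if "u \<rightarrow>\<^bsub>G\<^esub> v" for u v
      using that arcs_ends_symmetric[OF sym_arcs] by blast
    show "\<not> v \<rightarrow>\<^bsub>G\<^esub> v" for v using adj_not_same by blast
  qed
qed

lemma adj_induce_subgraph: "adj (G \<restriction> T) u v \<longleftrightarrow> u \<in> T \<and> v \<in> T \<and> adj G u v"
  by (auto simp: induce_subgraph_def arcs_ends_conv)

lemma colourable_induce_subgraph: "colourable (adj (G \<restriction> T)) T k \<longleftrightarrow> colourable (adj G) T k"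
  unfolding colourable_def adj_induce_subgraph by simp

lemma coverable_induce_subgraph: "coverable (adj (G \<restriction> T)) T f \<longleftrightarrow> coverable (adj G) T f"
proof -
  have "(K \<subseteq> T \<and> is_clique (adj (G \<restriction> T)) K) \<longleftrightarrow> (K \<subseteq> T \<and> is_clique (adj G) K)" for K
    unfolding is_clique_def adj_induce_subgraph by blast
  moreover have "(\<forall>u\<in>T. \<forall>v\<in>T. adj (G \<restriction> T) u v \<longrightarrow> (\<exists>K\<in>\<C>. u \<in> K \<and> v \<in> K)) \<longleftrightarrow>
      (\<forall>u\<in>T. \<forall>v\<in>T. adj G u v \<longrightarrow> (\<exists>K\<in>\<C>. u \<in> K \<and> v \<in> K))" for \<C>
    unfolding adj_induce_subgraph by simp
  ultimately show ?thesis unfolding coverable_def by simp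
qed

lemma colourable_iff_proper_colouring:
  assumes "graph G"
  shows "colourable (adj G) (verts G) k \<longleftrightarrow> (\<exists>c. proper_colouring G k c)"
proof -
  interpret graph G by fact
  have "(\<forall>u\<in>verts G. \<forall>v\<in>verts G. adj G u v \<longrightarrow> c u \<noteq> c v) \<longleftrightarrow>
      (\<forall>u v. adj G u v \<longrightarrow> c u \<noteq> c v)" for c :: "'a \<Rightarrow> nat"
    using adj_in_verts by blast
  then show ?thesis unfolding colourable_def proper_colouring_def by simp
qed

lemma chromatic_number_le:
  "graph G \<Longrightarrow> colourable (adj G) (verts G) k \<Longrightarrow> chromatic_number G \<le> k"
  unfolding chromatic_number_def by (intro Least_le) (simp add: colourable_iff_proper_colouring)

lemma colourable_chromatic_number:
  assumes "graph G" shows "colourable (adj G) (verts G) (chromatic_number G)"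
proof -
  interpret graph G by fact
  interpret adjacency "adj G" using assms by (rule adjacency_adj)
  have "\<exists>k. colourable (adj G) (verts G) k" using colourable_card[OF finite_verts] by blast
  then show ?thesis
    unfolding chromatic_number_def colourable_iff_proper_colouring[OF assms] by (rule LeastI_ex)
qed

lemma max_valency_le_iff:
  "finite (verts G) \<Longrightarrow> max_valency G \<C> \<le> m \<longleftrightarrow> (\<forall>v\<in>verts G. valency \<C> v \<le> m)"
  unfolding max_valency_def by (subst Max_le_iff) auto

lemma edge_clique_cover_iff:
  assumes "graph G"
  shows "edge_clique_cover G \<C> \<longleftrightarrow> (\<forall>K\<in>\<C>. K \<subseteq> verts G \<and> is_clique (adj G) K) \<and>
    (\<forall>u\<in>verts G. \<forall>v\<in>verts G. adj G u v \<longrightarrow> (\<exists>K\<in>\<C>. u \<in> K \<and> v \<in> K))"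
proof -
  interpret graph G by fact
  have "(\<forall>u\<in>verts G. \<forall>v\<in>verts G. adj G u v \<longrightarrow> (\<exists>K\<in>\<C>. u \<in> K \<and> v \<in> K)) \<longleftrightarrow>
      (\<forall>u v. adj G u v \<longrightarrow> (\<exists>K\<in>\<C>. u \<in> K \<and> v \<in> K))" (is "?L \<longleftrightarrow> ?R")
  proof
    assume L: ?L
    show ?R
    proof (intro allI impI)
      fix u v assume uv: "adj G u v"
      then show "\<exists>K\<in>\<C>. u \<in> K \<and> v \<in> K"
        using L[rule_format, OF adj_in_verts[OF uv] uv] by simp
    qed
  qed simp
  then show ?thesis unfolding edge_clique_cover_def clique_def is_clique_def by simp
qed

lemma coverable_iff_max_valency:
  assumes "graph G"
  shows "coverable (adj G) (verts G) (\<lambda>_. m) \<longleftrightarrow>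
    (\<exists>\<C>. edge_clique_cover G \<C> \<and> max_valency G \<C> \<le> m)"
proof -
  interpret graph G by fact
  show ?thesis
    unfolding coverable_def edge_clique_cover_iff[OF assms] max_valency_le_iff[OF finite_verts]
    by (simp add: conj_assoc)
qed

lemma lcc_le_iff:
  assumes "graph G"
  shows "lcc G \<le> m \<longleftrightarrow> coverable (adj G) (verts G) (\<lambda>_. m)"
proof -
  interpret graph G by fact
  let ?A = "{max_valency G \<C> | \<C>. edge_clique_cover G \<C>}"
  have "finite ?A" using finite_edge_clique_covers[OF finite_verts] by simp
  moreover have "?A \<noteq> {}" using edge_clique_cover_edge_ends[OF assms] by blast
  ultimately have "Min ?A \<le> m \<longleftrightarrow> (\<exists>x\<in>?A. x \<le> m)" by (rule Min_le_iff)
  then show ?thesis unfolding lcc_def coverable_iff_max_valency[OF assms] by auto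
qed

theorem lcc_plus_chromatic_number_le:
  assumes "graph G"
  shows "lcc G + chromatic_number G \<le> card (verts G) + 1"
proof -
  interpret graph G by fact
  interpret adjacency "adj G" using assms by (rule adjacency_adj)
  obtain m k where mk: "colourable (adj G) (verts G) k"
    "coverable (adj G) (verts G) (\<lambda>_. m)" "m + k \<le> card (verts G) + 1"
    using ex_cover_and_colouring[OF finite_verts] by blast
  have "lcc G \<le> m" using lcc_le_iff[OF assms] mk(2) by blast
  moreover have "chromatic_number G \<le> k" using chromatic_number_le[OF assms mk(1)] .
  ultimately show ?thesis using mk(3) by linarith
qed


section \<open>Extremal graphs\<close>

text \<open>
  The number \<open>s\<close> of \<open>coverable_add_edge\<close> is one less than the local clique cover number here, so it
  does not contribute to the maximum in \<open>coverable_add_2K2\<close> and \<open>coverable_add_3K2\<close>.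
\<close>
lemma extremal_lcc_le:
  assumes "graph G" "extremal G" "T \<subseteq> verts G"
    and cov: "\<And>s m. \<forall>k. colourable (adj G) (verts G) k \<longrightarrow> card (verts G) \<le> s + k \<Longrightarrow>
      coverable (adj G) T (\<lambda>_. m) \<Longrightarrow> coverable (adj G) (verts G) (\<lambda>_. max s (m + r))"
  shows "lcc G \<le> lcc (G \<restriction> T) + r"
proof -
  interpret graph G by fact
  interpret adjacency "adj G" using assms(1) by (rule adjacency_adj)
  have H: "graph (G \<restriction> T)" using assms(1,3) by (rule graph_induce_subgraph)
  let ?s = "card (verts G) - chromatic_number G"
  have "coverable (adj G) T (\<lambda>_. lcc (G \<restriction> T))"
    using lcc_le_iff[OF H, of "lcc (G \<restriction> T)"] by (simp add: coverable_induce_subgraph)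
  moreover have "\<forall>k. colourable (adj G) (verts G) k \<longrightarrow> card (verts G) \<le> ?s + k"
    using chromatic_number_le[OF assms(1)] by fastforce
  ultimately have "coverable (adj G) (verts G) (\<lambda>_. max ?s (lcc (G \<restriction> T) + r))"
    by (intro cov)
  then have "lcc G \<le> max ?s (lcc (G \<restriction> T) + r)" using lcc_le_iff[OF assms(1)] by blast
  moreover have "chromatic_number G \<le> card (verts G)"
    using chromatic_number_le[OF assms(1) colourable_card[OF finite_verts]] .
  then have "?s < lcc G" using assms(2) unfolding extremal_def by linarith
  ultimately show ?thesis by linarith
qed

lemma chromatic_number_le_induce:
  assumes "graph G" "T \<subseteq> verts G" "colourable (adj G) (verts G - T) r"
  shows "chromatic_number G \<le> chromatic_number (G \<restriction> T) + r"
proof (rule chromatic_number_le[OF assms(1)])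
  have H: "graph (G \<restriction> T)" using assms(1,2) by (rule graph_induce_subgraph)
  have "colourable (adj G) T (chromatic_number (G \<restriction> T))"
    using colourable_chromatic_number[OF H] by (simp add: colourable_induce_subgraph)
  from colourable_Un[OF this assms(3)]
  show "colourable (adj G) (verts G) (chromatic_number (G \<restriction> T) + r)"
    using assms(2) by (simp add: Un_absorb1)
qed

text \<open>
  The number of vertices drops by four, the local clique cover number and the chromatic number
  by at most two each, and the general bound holds for the rest: so there is equality throughout.
\<close>
lemma extremal_remove_2K2:
  assumes G: "graph G" "extremal G" and S: "{a, b, c, d} \<subseteq> verts G"
    and edges: "adj G a b" "adj G c d"
    and nonedges: "\<not> adj G a c" "\<not> adj G a d" "\<not> adj G b c" "\<not> adj G b d"
  defines "H \<equiv> G \<restriction> (verts G - {a, b, c, d})"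
  shows "extremal H \<and> chromatic_number G = chromatic_number H + 2 \<and> lcc G = lcc H + 2"
proof -
  interpret graph G by fact
  interpret adjacency "adj G" using G(1) by (rule adjacency_adj)
  let ?T = "verts G - {a, b, c, d}"
  have T: "?T \<subseteq> verts G" "verts G - ?T = {a, b, c, d}" using S by auto
  have H: "graph H" unfolding H_def using G(1) T(1) by (rule graph_induce_subgraph)
  have "a \<noteq> b" "c \<noteq> d" using edges irrefl by auto
  moreover have "a \<noteq> c" "a \<noteq> d" "b \<noteq> c" "b \<noteq> d"
    using disjoint_if_nonadjacent[OF edges nonedges] by blast+
  ultimately have "card {a, b, c, d} = 4" by simp
  then have card: "card (verts G) = card ?T + 4" using card_eq_card_Diff_add[OF finite_verts S] by simp
  have "lcc G \<le> lcc H + 2"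
    unfolding H_def
    by (rule extremal_lcc_le[OF G T(1)])
      (rule coverable_add_2K2[OF finite_verts S edges nonedges])
  moreover have "chromatic_number G \<le> chromatic_number H + 2"
    unfolding H_def
    by (rule chromatic_number_le_induce[OF G(1) T(1)])
      (unfold T(2), rule colourable_alternating_cycle[OF nonedges(1,4)])
  moreover have "lcc H + chromatic_number H \<le> card ?T + 1"
    using lcc_plus_chromatic_number_le[OF H] by (simp add: H_def)
  moreover have "verts H = ?T" by (simp add: H_def)
  ultimately show ?thesis
    using G(2) card unfolding extremal_def by (simp only:) linarith
qed

text \<open>
  Removing \<open>3K\<^sub>2\<close> lowers \<open>lcc\<close> by at most three and the chromatic number by two, but the
  number of vertices by six.
\<close>
lemma extremal_no_3K2:
  assumes G: "graph G" "extremal G" and S: "{a, b, c, d, e, f} \<subseteq> verts G"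
    and edges: "adj G a b" "adj G c d" "adj G e f"
    and nonedges: "\<not> adj G a c" "\<not> adj G a d" "\<not> adj G b c" "\<not> adj G b d"
      "\<not> adj G a e" "\<not> adj G a f" "\<not> adj G b e" "\<not> adj G b f"
      "\<not> adj G c e" "\<not> adj G c f" "\<not> adj G d e" "\<not> adj G d f"
  shows False
proof -
  interpret graph G by fact
  interpret adjacency "adj G" using G(1) by (rule adjacency_adj)
  let ?T = "verts G - {a, b, c, d, e, f}"
  have T: "?T \<subseteq> verts G" "verts G - ?T = {a, b, c, d, e, f}" using S by auto
  have H: "graph (G \<restriction> ?T)" using G(1) T(1) by (rule graph_induce_subgraph)
  have "a \<noteq> b" "c \<noteq> d" "e \<noteq> f" using edges irrefl by auto
  moreover have "a \<noteq> c" "a \<noteq> d" "b \<noteq> c" "b \<noteq> d" "a \<noteq> e" "a \<noteq> f" "b \<noteq> e" "b \<noteq> f"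
    "c \<noteq> e" "c \<noteq> f" "d \<noteq> e" "d \<noteq> f"
    using disjoint_if_nonadjacent[OF edges(1,2) nonedges(1-4)]
      disjoint_if_nonadjacent[OF edges(1,3) nonedges(5-8)]
      disjoint_if_nonadjacent[OF edges(2,3) nonedges(9-12)] by blast+
  ultimately have "card {a, b, c, d, e, f} = 6" by simp
  then have card: "card (verts G) = card ?T + 6" using card_eq_card_Diff_add[OF finite_verts S] by simp
  have "colourable (adj G) {a, b, c, d, e, f} 2"
  proof -
    let ?c = "\<lambda>v. if v \<in> {a, c, e} then 0 else 1 :: nat"
    have "\<not> adj G u v" if "u \<in> {a, c, e}" "v \<in> {a, c, e}" for u v
      using that nonedges nonedges[THEN contrapos_nn[OF _ sym]] irrefl by blast
    moreover have "\<not> adj G u v" if "u \<in> {b, d, f}" "v \<in> {b, d, f}" for u v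
      using that nonedges nonedges[THEN contrapos_nn[OF _ sym]] irrefl by blast
    ultimately have "colourable (adj G) {a, c, e} 1" "colourable (adj G) {b, d, f} 1"
      unfolding colourable_def by (intro exI[of _ "\<lambda>_. 0"]; simp)+
    from colourable_Un[OF this] show ?thesis
      by (simp add: insert_commute numeral_2_eq_2)
  qed
  then have "chromatic_number G \<le> chromatic_number (G \<restriction> ?T) + 2"
    by (intro chromatic_number_le_induce[OF G(1) T(1)]) (unfold T(2))
  moreover have "lcc G \<le> lcc (G \<restriction> ?T) + 3"
    by (rule extremal_lcc_le[OF G T(1)])
      (rule coverable_add_3K2[OF finite_verts S edges nonedges])
  moreover have "lcc (G \<restriction> ?T) + chromatic_number (G \<restriction> ?T) \<le> card ?T + 1"
    using lcc_plus_chromatic_number_le[OF H] by simp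
  ultimately show False using G(2) card unfolding extremal_def by linarith
qed

lemma induced_matching_nonadjacent:
  assumes M: "induced_matching G M" and e: "e \<in> M" "e' \<in> M" "e \<noteq> e'" "p \<in> e" "q \<in> e'"
  shows "\<not> adj G p q"
proof
  assume "adj G p q"
  then have "{p, q} \<in> edge_ends (G \<restriction> \<Union>M)"
    using e by (auto simp: edge_ends_def adj_induce_subgraph)
  then have "{p, q} \<in> M" using M unfolding induced_matching_def by simp
  have same: "x = y" if "x \<in> M" "y \<in> M" "r \<in> x" "r \<in> y" for x y r
  proof (rule ccontr)
    assume "x \<noteq> y"
    then have "disjnt x y"
      using M that(1,2) unfolding induced_matching_def by (blast dest: pairwiseD)
    then show False using that(3,4) by (auto simp: disjnt_iff)
  qed
  have "{p, q} = e" by (rule same[OF \<open>{p, q} \<in> M\<close> e(1) _ e(4)]) simp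
  moreover have "{p, q} = e'" by (rule same[OF \<open>{p, q} \<in> M\<close> e(2) _ e(5)]) simp
  ultimately show False using e(3) by simp
qed

lemma induced_2K2_obtain:
  assumes "digraph_iso (G \<restriction> S) (with_proj two_K2)"
  obtains a b c d where "S = {a, b, c, d}" "adj G a b" "adj G c d"
    "\<not> adj G a c" "\<not> adj G a d" "\<not> adj G b c" "\<not> adj G b d"
proof -
  let ?H = "G \<restriction> S"
  obtain f where f: "pre_digraph.digraph_isomorphism ?H f" and eq: "with_proj two_K2 = app_iso f ?H"
    using assms unfolding digraph_iso_def by blast
  let ?g = "iso_verts f"
  have inj: "inj_on ?g S" using f by (simp add: pre_digraph.digraph_isomorphism_def)
  have im: "?g ` S = {0, 1, 2, 3}"
    using arg_cong[OF eq, of verts] by (simp add: two_K2_def)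
  interpret wf_digraph ?H using f by (simp add: pre_digraph.digraph_isomorphism_def)
  have arcs: "arcs_ends (with_proj two_K2) = (\<lambda>(u, v). (?g u, ?g v)) ` arcs_ends ?H"
    unfolding eq by (rule arcs_ends_app_iso_eq[OF f])
  have adj: "adj G u v \<longleftrightarrow> (?g u, ?g v) \<in> {(0, 1), (1, 0), (2, 3), (3, 2)}"
    if uv: "u \<in> S" "v \<in> S" for u v
  proof -
    have "adj G u v \<longleftrightarrow> (u, v) \<in> arcs_ends ?H" using uv by (simp add: adj_induce_subgraph)
    also have "\<dots> \<longleftrightarrow> (?g u, ?g v) \<in> (\<lambda>(u, v). (?g u, ?g v)) ` arcs_ends ?H"
    proof
      assume "(?g u, ?g v) \<in> (\<lambda>(u, v). (?g u, ?g v)) ` arcs_ends ?H"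
      then obtain x y where xy: "(x, y) \<in> arcs_ends ?H" "?g u = ?g x" "?g v = ?g y" by auto
      then have "x \<in> S" "y \<in> S" using adj_induce_subgraph[where G = G and T = S and u = x and v = y] by auto
      then show "(u, v) \<in> arcs_ends ?H" using xy uv inj_onD[OF inj] by metis
    qed auto
    finally show ?thesis unfolding arcs[symmetric] by (simp add: two_K2_def)
  qed
  have preimage: "\<exists>v\<in>S. ?g v = i" if "i \<in> {0, 1, 2, 3}" for i
  proof -
    have "i \<in> ?g ` S" using im that by simp
    then show ?thesis by auto
  qed
  obtain a where a: "a \<in> S" "?g a = 0" using preimage[of 0] by blast
  obtain b where b: "b \<in> S" "?g b = 1" using preimage[of 1] by blast
  obtain c where c: "c \<in> S" "?g c = 2" using preimage[of 2] by blast
  obtain d where d: "d \<in> S" "?g d = 3" using preimage[of 3] by blast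
  note S = a(1) b(1) c(1) d(1) and g = a(2) b(2) c(2) d(2)
  have "S = {a, b, c, d}"
  proof
    show "S \<subseteq> {a, b, c, d}"
    proof
      fix v assume v: "v \<in> S"
      then have "?g v \<in> {0, 1, 2, 3}" using im by blast
      then have "?g v \<in> {?g a, ?g b, ?g c, ?g d}" unfolding g .
      then show "v \<in> {a, b, c, d}" using inj_onD[OF inj _ v] S by blast
    qed
  qed (use S in simp)
  then show thesis
    by (rule that) (use S g in \<open>simp_all add: adj\<close>)
qed

lemma extremal_induced_matching_number_le:
  assumes G: "graph G" "extremal G"
  shows "induced_matching_number G \<le> 2"
proof -
  have le: "card M \<le> 2" if M: "induced_matching G M" for M
  proof (rule ccontr)
    assume "\<not> card M \<le> 2"
    then have "3 \<le> card M" by simp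
    then obtain N where "N \<subseteq> M" "card N = 3" by (rule obtain_subset_with_card_n)
    then obtain x y z where xyz: "x \<in> M" "y \<in> M" "z \<in> M" "x \<noteq> y" "x \<noteq> z" "y \<noteq> z"
      by (auto simp: card_3_iff)
    interpret graph G by fact
    have ends: "\<exists>u v. e = {u, v} \<and> adj G u v" if "e \<in> M" for e
      using M that by (auto simp: induced_matching_def edge_ends_def)
    obtain a b where ab: "x = {a, b}" "adj G a b" using ends[OF xyz(1)] by blast
    obtain c d where cd: "y = {c, d}" "adj G c d" using ends[OF xyz(2)] by blast
    obtain e f where ef: "z = {e, f}" "adj G e f" using ends[OF xyz(3)] by blast
    have xy: "\<not> adj G p q" if "p \<in> x" "q \<in> y" for p q
      using induced_matching_nonadjacent[OF M xyz(1,2,4) that] .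
    have xz: "\<not> adj G p q" if "p \<in> x" "q \<in> z" for p q
      using induced_matching_nonadjacent[OF M xyz(1,3,5) that] .
    have yz: "\<not> adj G p q" if "p \<in> y" "q \<in> z" for p q
      using induced_matching_nonadjacent[OF M xyz(2,3,6) that] .
    show False
    proof (rule extremal_no_3K2[OF G _ ab(2) cd(2) ef(2)])
      show "{a, b, c, d, e, f} \<subseteq> verts G" using ab(2) cd(2) ef(2) adj_in_verts by blast
    qed (simp_all add: xy xz yz ab(1) cd(1) ef(1))
  qed
  let ?A = "{card M | M. induced_matching G M}"
  have "finite ?A" using finite_induced_matchings[OF G(1)] by simp
  moreover have "?A \<noteq> {}" using induced_matching_empty by blast
  ultimately show ?thesis
    unfolding induced_matching_number_def using le by (subst Max_le_iff) auto
qed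

theorem corollary3p4:
  fixes G :: "('a, 'b) pre_digraph"
  assumes "graph G" and "extremal G"
  shows "induced_matching_number G \<le> 2 \<and>
    (\<forall>S \<subseteq> verts G. card S = 4 \<and> digraph_iso (G \<restriction> S) (with_proj two_K2) \<longrightarrow>
       (let H = G \<restriction> (verts G - S) in
          extremal H \<and>
          int (chromatic_number H) = int (chromatic_number G) - 2 \<and>
          int (lcc H) = int (lcc G) - 2))"
proof (intro conjI allI impI extremal_induced_matching_number_le[OF assms])
  fix S assume S: "S \<subseteq> verts G" and "card S = 4 \<and> digraph_iso (G \<restriction> S) (with_proj two_K2)"
  then have iso: "digraph_iso (G \<restriction> S) (with_proj two_K2)" by blast
  obtain a b c d where abcd: "S = {a, b, c, d}" "adj G a b" "adj G c d"
    "\<not> adj G a c" "\<not> adj G a d" "\<not> adj G b c" "\<not> adj G b d"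
    by (rule induced_2K2_obtain[OF iso])
  from extremal_remove_2K2[OF assms S[unfolded abcd(1)] abcd(2-)]
  show "let H = G \<restriction> (verts G - S) in
      extremal H \<and>
      int (chromatic_number H) = int (chromatic_number G) - 2 \<and>
      int (lcc H) = int (lcc G) - 2"
    unfolding Let_def abcd(1) by linarith
qed

end
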